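(* Suppose that $W$ satisfies the second structural condition and let $p\in(1,\infty)$. Then there is a constant $C$, independent of $F$, such that for all $F\in\mathfrak{W}$ $$\sum_{n=1}^\infty m^{-\frac{p-1}{p}n}\,\|f_n\|_{L_{p,1}}\le C\,\|F\|_{\mathfrak{W}}.$$
   Context: Fix integers $m\ge 3$ and $\ell\ge 1$. Consider a probability space with an $m$-uniform filtration $\mathcal{F}=\{\mathcal{F}_n\}_{n\ge0}$: $\mathcal{F}_0$ is trivial, each $\mathcal{F}_n$ is a finite algebra with set of atoms $\mathcal{AF}_n$, and each atom in $\mathcal{F}_n$ is split into $m$ atoms of $\mathcal{F}_{n+1}$ (its children) of equal probability. All martingales are adapted to $\mathcal{F}$; for a martingale $F=\{F_n\}_{n\ge0}$ put $f_{n+1}=F_{n+1}-F_n$, $n\ge 0$. The norm $\|\cdot\|$ on $\mathbb{R}^\ell$ is Euclidean. Let $V=\{v\in\mathbb{R}^m : \sum_{j=1}^m v_j=0\}$. Elements of $V^\ell$ are identified with $m$-tuples $\{b_j\}_{j=1}^m$ of vectors $b_j\in\mathbb{R}^\ell$ with $\sum_j b_j=0$; for $v\in V$, $a\in\mathbb{R}^\ell$, $v\otimes a=\{v_j a\}_{j=1}^m$. For each $n$ and $\omega\in\mathcal{AF}_n$ fix a bijection $J_\omega$ from $\{1,\dots,m\}$ onto the set of children of $\omega$; for $b\in V^\ell$ let $J_\omega[b]$ be the function on $\omega$ equal to $b_j$ on the child $J_\omega(j)$. Let $W$ be a linear subspace of $V^\ell$. $L_1(\mathbb{R}^\ell)$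 is the space of $\mathbb{R}^\ell$-valued martingales with $\|F\|_{L_1}=\sup_n\mathbb{E}\|F_n\|<\infty$, and $$\mathfrak{W}=\{F\in L_1(\mathbb{R}^\ell) : \forall n\ge0,\ \forall\omega\in\mathcal{AF}_n,\ f_{n+1}|_\omega\in J_\omega[W]\},$$ with the norm $\|F\|_{\mathfrak{W}}=\|F\|_{L_1}$. Second structural condition on $W$: $W$ contains no non-zero vector $v\otimes a$ with $a\in\mathbb{R}^\ell$ and $v\in V$ having $m-1$ equal coordinates. $L_{p,1}$ is the Lorentz space; for a vector-valued function $g$, $\|g\|_{L_{p,1}}$ is the $L_{p,1}$ (quasi-)norm of the scalar function $\|g\|$. *)

theory Defs
  imports "HOL-Probability.Probability"
begin

text \<open>The algebras of a filtration are the sets of the measures \<open>F n\<close>; the measure carried by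
  \<open>F n\<close> itself is irrelevant.\<close>

definition atoms :: "'a measure \<Rightarrow> 'a set set" where
  "atoms N = {A \<in> sets N. A \<noteq> {} \<and> (\<forall>B\<in>sets N. B \<subseteq> A \<longrightarrow> B = {} \<or> B = A)}"

definition children :: "(nat \<Rightarrow> 'a measure) \<Rightarrow> nat \<Rightarrow> 'a set \<Rightarrow> 'a set set" where
  "children F n \<omega> = {\<omega>' \<in> atoms (F (Suc n)). \<omega>' \<subseteq> \<omega>}"

definition uniform_filtration :: "nat \<Rightarrow> 'a measure \<Rightarrow> (nat \<Rightarrow> 'a measure) \<Rightarrow> bool" where
  "uniform_filtration m M F \<longleftrightarrow>
     filtration (space M) F \<and>
     (\<forall>n. subalgebra M (F n)) \<and>
     sets (F 0) = {{}, space M} \<and>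
     (\<forall>n. finite (sets (F n))) \<and>
     (\<forall>n. \<forall>\<omega>\<in>atoms (F n).
        card (children F n \<omega>) = m \<and>
        (\<forall>c\<in>children F n \<omega>. \<forall>c'\<in>children F n \<omega>. measure M c = measure M c'))"

text \<open>Conditional expectations of vector-valued functions are taken coordinatewise.\<close>

definition is_martingale ::
  "'a measure \<Rightarrow> (nat \<Rightarrow> 'a measure) \<Rightarrow> (nat \<Rightarrow> 'a \<Rightarrow> real ^ 'l) \<Rightarrow> bool" where
  "is_martingale M F X \<longleftrightarrow>
     (\<forall>n. X n \<in> borel_measurable (F n)) \<and>
     (\<forall>n. integrable M (X n)) \<and>
     (\<forall>n i. AE x in M. real_cond_exp M (F n) (\<lambda>x. X (Suc n) x $ i) x = X n x $ i)"

definition L1_norm :: "'a measure \<Rightarrow> (nat \<Rightarrow> 'a \<Rightarrow> real ^ 'l) \<Rightarrow> ennreal" where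
  "L1_norm M X = (SUP n. \<integral>\<^sup>+x. ennreal (norm (X n x)) \<partial>M)"

text \<open>With \<open>'b = real\<close> this is \<open>V\<close>; with \<open>'b = real ^ 'l\<close> it is \<open>V\<^sup>\<ell>\<close>, where \<open>\<ell> = CARD('l)\<close>.
  The index set \<open>{1,\<dots>,m}\<close> is represented by the type \<open>'m\<close>.\<close>

definition zero_sum :: "('b::comm_monoid_add ^ 'm) set" where
  "zero_sum = {b. (\<Sum>j\<in>UNIV. b $ j) = 0}"

definition tensor :: "real ^ 'm \<Rightarrow> real ^ 'l \<Rightarrow> real ^ 'l ^ 'm" where
  "tensor v a = (\<chi> j. v $ j *\<^sub>R a)"

definition second_structural_condition :: "(real ^ 'l ^ 'm) set \<Rightarrow> bool" where
  "second_structural_condition W \<longleftrightarrow>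
     \<not> (\<exists>v a. v \<in> zero_sum \<and>
          (\<exists>S. card S = CARD('m) - 1 \<and> (\<forall>i\<in>S. \<forall>j\<in>S. v $ i = v $ j)) \<and>
          tensor v a \<in> W \<and> tensor v a \<noteq> 0)"

text \<open>\<open>equals_on_children K b g\<close> says that the restriction of \<open>g\<close> to \<open>\<omega>\<close> is \<open>J\<^sub>\<omega>[b]\<close>, where
  \<open>K = J\<^sub>\<omega>\<close>; the children \<open>K j\<close> cover \<open>\<omega>\<close>.\<close>

definition equals_on_children ::
  "('m \<Rightarrow> 'a set) \<Rightarrow> real ^ 'l ^ 'm \<Rightarrow> ('a \<Rightarrow> real ^ 'l) \<Rightarrow> bool" where
  "equals_on_children K b g \<longleftrightarrow> (\<forall>j. \<forall>x\<in>K j. g x = b $ j)"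

definition W_space ::
  "'a measure \<Rightarrow> (nat \<Rightarrow> 'a measure) \<Rightarrow> ('a set \<Rightarrow> 'm \<Rightarrow> 'a set) \<Rightarrow> (real ^ 'l ^ 'm) set
     \<Rightarrow> (nat \<Rightarrow> 'a \<Rightarrow> real ^ 'l) set" where
  "W_space M F J W =
     {X. is_martingale M F X \<and> L1_norm M X < \<infinity> \<and>
         (\<forall>n. \<forall>\<omega>\<in>atoms (F n). \<exists>b\<in>W.
            equals_on_children (J \<omega>) b (\<lambda>x. X (Suc n) x - X n x))}"

definition decreasing_rearrangement ::
  "'a measure \<Rightarrow> ('a \<Rightarrow> 'b::real_normed_vector) \<Rightarrow> real \<Rightarrow> ennreal" where
  "decreasing_rearrangement M g t =
     Inf {s. emeasure M {x \<in> space M. s < ennreal (norm (g x))} \<le> ennreal t}"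

text \<open>The usual \<open>L\<^bsub>p,1\<^esub>\<close> quasi-norm, the integral of \<open>t\<^bsup>1/p\<^esup> g\<^sup>*(t)\<close> over \<open>(0,\<infinity>)\<close> against \<open>dt/t\<close>.\<close>

definition Lorentz_p1_norm ::
  "'a measure \<Rightarrow> real \<Rightarrow> ('a \<Rightarrow> 'b::real_normed_vector) \<Rightarrow> ennreal" where
  "Lorentz_p1_norm M p g =
     (\<integral>\<^sup>+t\<in>{0<..}. ennreal (t powr (1 / p) / t) * decreasing_rearrangement M g t \<partial>lborel)"

end

theory Submission
  imports Defs
begin

text \<open>
  The obstruction to the inequality is a martingale that behaves like a point mass, putting all of
  its mass on one child at every step. Such a step from the value \<open>x\<close> has the differences
  \<open>tensor v x\<close> with \<open>v = (m - 1, - 1, \<dots>, - 1)\<close>, which the second structural condition excludes from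
  \<open>W\<close>. By linear algebra in finite dimension the exclusion is quantitative (\<open>structural_gap\<close>): the
  mass \<open>E (norm X\<^sub>n\<^sub>+\<^sub>1; c)\<close> of each child \<open>c\<close> of an atom \<open>\<omega>\<close> is at most the total mass of
  the children of \<open>\<omega>\<close> minus \<open>\<delta>\<close> times the mass of \<open>\<omega>\<close>.

  So there is a dichotomy at each atom. Either the mass increases by a fixed proportion in passing to the
  children, or every child has at most \<open>\<theta> < 1\<close> times the mass of the parent. Increases of the
  first kind (bad atoms) are paid for by the telescoping sum of the increments of \<open>E (norm X\<^sub>n)\<close>,
  which is bounded by the \<open>L\<^sub>1\<close> norm. Sorting the atoms of level \<open>n\<close> by the level \<open>k\<close>
  that follows their last bad ancestor (\<open>good_children_cover\<close>), the piece with index \<open>k\<close> has total mass at most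
  \<open>(1 + \<epsilon>) ^ (n - k) * D k\<close> and masses of single atoms at most \<open>\<theta> ^ (n - k) * D k\<close>, with \<open>D k\<close>
  proportional to the increment at step \<open>k\<close>.

  The \<open>L\<^bsub>p,1\<^esub>\<close> norm with its weight lies between the \<open>L\<^sub>1\<close> norm and \<open>m ^ (- n)\<close> times the supremum
  norm, with exponents \<open>1 / p\<close> and \<open>1 - 1 / p\<close>. The piece \<open>k\<close> therefore contributes at most
  a constant times \<open>\<rho> ^ (n - k) * D k\<close>, where \<open>\<rho> = (1 + \<epsilon>) powr (1 / p) * \<theta> powr (1 - 1 / p)\<close> is
  less than \<open>1\<close> for small \<open>\<epsilon>\<close> because \<open>p > 1\<close>. The norm is bounded by the integral of
  \<open>P (norm g > u) powr (1 / p)\<close> over \<open>u\<close> (\<open>Lorentz_p1_norm_le_distribution\<close>); as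
  \<open>y powr (1 / p)\<close> is subadditive, the contributions of the pieces add up (\<open>distribution_integral_le\<close>), and summing
  the geometric series over \<open>n\<close> leaves \<open>\<Sum>k. D k\<close>. This is done for \<open>X\<^sub>n\<close> itself; the difference
  \<open>f\<^sub>n\<^sub>+\<^sub>1\<close> inherits the bound from \<open>X\<^sub>n\<close> and \<open>X\<^sub>n\<^sub>+\<^sub>1\<close>.
\<close>

section \<open>The structural condition as a lower bound\<close>

text \<open>This is the only use of the structural condition. If all the vectors \<open>x + b $ i\<close> with \<open>i \<noteq> j\<close>
  vanish, then the zero sum forces \<open>b = tensor v x\<close> where \<open>v\<close> equals \<open>- 1\<close> off \<open>j\<close>, and such a vector
  belongs to \<open>W\<close> only if it is zero. So the linear map that sends \<open>(x, b)\<close> to these vectors is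
  injective on \<open>UNIV \<times> W\<close>, and an injective linear map in finite dimension is bounded below.
  In terms of martingales: a definite share of the mass of an atom goes to children other than any
  prescribed one.\<close>

lemma structural_gap:
  fixes W :: "(real ^ 'l::finite ^ 'm::finite) set"
  assumes m: "2 \<le> CARD('m)"
    and W: "subspace W" "W \<subseteq> zero_sum" "second_structural_condition W"
  shows "\<exists>\<delta>>0. \<forall>x. \<forall>b\<in>W. \<forall>j. \<delta> * norm x \<le> (\<Sum>i\<in>UNIV - {j}. norm (x + b $ i))"
proof -
  have "\<exists>\<delta>>0. \<forall>x. \<forall>b\<in>W. \<delta> * norm x \<le> (\<Sum>i\<in>UNIV - {j}. norm (x + b $ i))" for j :: 'm
  proof -
    define f :: "(real ^ 'l) \<times> (real ^ 'l ^ 'm) \<Rightarrow> real ^ 'l ^ 'm"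
      where "f = (\<lambda>z. \<chi> i. if i = j then 0 else fst z + snd z $ i)"
    have sub: "subspace (UNIV \<times> W)"
      using W(1) by (intro subspace_Times) auto
    have lin: "linear f"
      by (rule linearI) (auto simp: f_def vec_eq_iff algebra_simps)
    have inj: "z = 0" if z: "z \<in> UNIV \<times> W" "f z = 0" for z
    proof -
      obtain x b where zb: "z = (x, b)" by (cases z)
      have b: "b \<in> W" and b0: "(\<Sum>i\<in>UNIV. b $ i) = 0"
        using z W(2) by (auto simp: zb zero_sum_def)
      have bi: "b $ i = - x" if "i \<noteq> j" for i
      proof -
        have "f z $ i = 0" using z(2) by simp
        then have "b $ i + x = 0" using that by (simp add: f_def zb add.commute)
        then show ?thesis by (simp add: eq_neg_iff_add_eq_0)
      qed
      have "b $ j = - (\<Sum>i\<in>UNIV - {j}. b $ i)"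
        using b0 by (simp add: sum.remove[of UNIV j] eq_neg_iff_add_eq_0)
      also have "\<dots> = real (CARD('m) - 1) *\<^sub>R x"
        by (simp add: bi sum_negf sum_constant_scaleR del: sum_constant)
      finally have bj: "b $ j = real (CARD('m) - 1) *\<^sub>R x" .
      define v :: "real ^ 'm" where "v = (\<chi> i. if i = j then real (CARD('m) - 1) else - 1)"
      have bt: "b = tensor v x"
        by (auto simp: vec_eq_iff tensor_def v_def bi bj)
      have "(\<Sum>i\<in>UNIV. v $ i) = v $ j + (\<Sum>i\<in>UNIV - {j}. v $ i)"
        by (simp add: sum.remove[of UNIV j])
      also have "\<dots> = 0" by (simp add: v_def)
      finally have v0: "v \<in> zero_sum" by (simp add: zero_sum_def)
      have S: "\<exists>S. card S = CARD('m) - 1 \<and> (\<forall>i\<in>S. \<forall>k\<in>S. v $ i = v $ k)"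
        by (rule exI[of _ "UNIV - {j}"]) (auto simp: v_def)
      have "b = 0"
        using W(3) v0 S b unfolding second_structural_condition_def bt by blast
      moreover obtain i :: 'm where "i \<noteq> j"
      proof -
        have "UNIV \<noteq> {j}" using m by (metis card_1_singleton_iff One_nat_def numeral_le_one_iff semiring_norm(69))
        then show ?thesis using that by blast
      qed
      ultimately show ?thesis using bi[of i] by (simp add: zb zero_prod_def)
    qed
    obtain e where e: "e > 0" "\<And>z. z \<in> UNIV \<times> W \<Longrightarrow> e * norm z \<le> norm (f z)"
      using injective_imp_isometric[OF closed_subspace[OF sub] sub, of f] lin inj
      by (auto simp: linear_conv_bounded_linear)
    have "e * norm x \<le> (\<Sum>i\<in>UNIV - {j}. norm (x + b $ i))" if "b \<in> W" for x b
    proof -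
      have "e * norm x \<le> e * norm (x, b)"
        using e(1) norm_fst_le[of x b] by simp
      also have "\<dots> \<le> norm (f (x, b))" using e(2)[of "(x, b)"] that by simp
      also have "\<dots> \<le> (\<Sum>i\<in>UNIV. norm (f (x, b) $ i))"
        unfolding norm_vec_def by (rule L2_set_le_sum) simp
      also have "\<dots> = (\<Sum>i\<in>UNIV - {j}. norm (x + b $ i))"
        by (simp add: sum.remove[of UNIV j] f_def)
      finally show ?thesis .
    qed
    then show ?thesis using e(1) by blast
  qed
  then obtain d where d: "\<And>j::'m. d j > 0"
      "\<And>j x b. b \<in> W \<Longrightarrow> d j * norm x \<le> (\<Sum>i\<in>UNIV - {j}. norm (x + b $ i))"
    by metis
  define e where "e = Min (range d)"
  have "e > 0" unfolding e_def using d(1) by (subst Min_gr_iff) auto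
  moreover have "e * norm x \<le> (\<Sum>i\<in>UNIV - {j}. norm (x + b $ i))" if "b \<in> W" for x b and j :: 'm
    using d(2)[OF that, of j x] by (rule order_trans[rotated]) (auto simp: e_def intro!: mult_right_mono)
  ultimately show ?thesis by blast
qed

section \<open>Masses on a tree: good and bad atoms\<close>

text \<open>The numbers \<open>s n \<omega>\<close> are the masses \<open>E (norm X\<^sub>n; \<omega>)\<close> of the atoms of level \<open>n\<close>, and \<open>A n\<close> is the set of these
  atoms. Call an atom bad if the mass of its children exceeds its own by more than the factor
  \<open>1 + \<epsilon>\<close>. The set \<open>G k\<close> consists of the atoms of level \<open>n\<close> whose most recent bad proper ancestor has
  level \<open>k - 1\<close>; for \<open>k = 0\<close>, those without a bad proper ancestor. A bad atom
  is paid for by the growth of the total mass at its level, whence the factor \<open>D k\<close>. Along good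
  atoms the total mass grows at most by \<open>1 + \<epsilon>\<close> at each step, while by \<open>spread\<close> the
  largest mass is multiplied by at most \<open>1 + \<epsilon> - \<delta>\<close>. The sets are built by induction on \<open>n\<close>, so only
  their existence is recorded.\<close>

lemma good_children_cover:
  fixes A :: "nat \<Rightarrow> 'b set" and ch :: "nat \<Rightarrow> 'b \<Rightarrow> 'b set" and s :: "nat \<Rightarrow> 'b \<Rightarrow> real"
    and \<epsilon> \<delta> :: real and D :: "nat \<Rightarrow> real"
  assumes fin: "\<And>n. finite (A n)" and root: "A 0 = {r}"
    and split: "\<And>n. A (Suc n) = (\<Union>\<omega>\<in>A n. ch n \<omega>)"
    and disj: "\<And>n. disjoint_family_on (ch n) (A n)"
    and nonneg: "\<And>n \<omega>. 0 \<le> s n \<omega>"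
    and grow: "\<And>n \<omega>. \<omega> \<in> A n \<Longrightarrow> s n \<omega> \<le> sum (s (Suc n)) (ch n \<omega>)"
    and spread: "\<And>n \<omega> c. \<omega> \<in> A n \<Longrightarrow> c \<in> ch n \<omega> \<Longrightarrow>
                   s (Suc n) c + \<delta> * s n \<omega> \<le> sum (s (Suc n)) (ch n \<omega>)"
    and \<epsilon>: "0 < \<epsilon>" and \<delta>: "\<delta> \<le> 1"
    and D0: "D 0 = s 0 r"
    and DSuc: "\<And>n. D (Suc n) = (1 + 1 / \<epsilon>) * (sum (s (Suc n)) (A (Suc n)) - sum (s n) (A n))"
  shows "\<exists>G. A n = (\<Union>k\<le>n. G k) \<and>
           (\<forall>k\<le>n. sum (s n) (G k) \<le> (1 + \<epsilon>) ^ (n - k) * D k \<and>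
                  (\<forall>\<omega>\<in>G k. s n \<omega> \<le> (1 + \<epsilon> - \<delta>) ^ (n - k) * D k))"
proof (induction n)
  case 0
  show ?case
    by (rule exI[of _ "\<lambda>k. {r}"]) (simp add: root D0)
next
  case (Suc n)
  obtain G where GG: "A n = (\<Union>k\<le>n. G k) \<and>
      (\<forall>k\<le>n. sum (s n) (G k) \<le> (1 + \<epsilon>) ^ (n - k) * D k \<and>
             (\<forall>\<omega>\<in>G k. s n \<omega> \<le> (1 + \<epsilon> - \<delta>) ^ (n - k) * D k))"
    by (rule exE[OF Suc.IH])
  have G: "A n = (\<Union>k\<le>n. G k)"
    and Gsum: "\<And>k. k \<le> n \<Longrightarrow> sum (s n) (G k) \<le> (1 + \<epsilon>) ^ (n - k) * D k"
    and Gmax: "\<And>k \<omega>. k \<le> n \<Longrightarrow> \<omega> \<in> G k \<Longrightarrow> s n \<omega> \<le> (1 + \<epsilon> - \<delta>) ^ (n - k) * D k"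
    using GG by simp_all
  define t where "t \<omega> = sum (s (Suc n)) (ch n \<omega>)" for \<omega>
  define bad where "bad = {\<omega> \<in> A n. t \<omega> > (1 + \<epsilon>) * s n \<omega>}"
  define G' where "G' k = (\<Union>\<omega>\<in>(if k = Suc n then bad else G k - bad). ch n \<omega>)" for k
  have finch: "finite (ch n \<omega>)" if "\<omega> \<in> A n" for \<omega>
    using finite_subset[OF _ fin[of "Suc n"], of "ch n \<omega>"] that by (auto simp: split)
  have GA: "G k \<subseteq> A n" if "k \<le> n" for k using G that by auto
  have badA: "bad \<subseteq> A n" by (auto simp: bad_def)
  have sum_ch: "sum (s (Suc n)) (\<Union>\<omega>\<in>B. ch n \<omega>) = sum t B" if B: "B \<subseteq> A n" for B
    unfolding t_def
    using B disj[of n] finite_subset[OF B fin]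
    by (intro sum.UNION_disjoint) (auto simp: disjoint_family_on_def finch subset_iff)
  have D1: "D (Suc n) = (1 + 1 / \<epsilon>) * (\<Sum>\<omega>\<in>A n. t \<omega> - s n \<omega>)"
    using sum_ch[of "A n"] by (simp add: DSuc split sum_subtractf)
  \<comment> \<open>Badness means that the growth is at least \<open>\<epsilon>\<close> times the mass, so the growth controls all of \<open>t \<omega>\<close>.\<close>
  have bad_t: "t \<omega> \<le> (1 + 1 / \<epsilon>) * (t \<omega> - s n \<omega>)" if "\<omega> \<in> bad" for \<omega>
  proof -
    have "\<epsilon> * s n \<omega> \<le> t \<omega> - s n \<omega>" using that by (auto simp: bad_def algebra_simps)
    then show ?thesis using \<epsilon> by (simp add: field_simps)
  qed
  have sum_bad: "sum t bad \<le> D (Suc n)"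
  proof -
    have "sum t bad \<le> (\<Sum>\<omega>\<in>bad. (1 + 1 / \<epsilon>) * (t \<omega> - s n \<omega>))"
      by (intro sum_mono bad_t)
    also have "\<dots> \<le> (\<Sum>\<omega>\<in>A n. (1 + 1 / \<epsilon>) * (t \<omega> - s n \<omega>))"
      using badA grow \<epsilon> by (intro sum_mono2 fin) (auto simp: t_def intro!: mult_nonneg_nonneg)
    finally show ?thesis by (simp add: D1 sum_distrib_left)
  qed
  have cover: "A (Suc n) = (\<Union>k\<le>Suc n. G' k)"
  proof
    show "A (Suc n) \<subseteq> (\<Union>k\<le>Suc n. G' k)"
    proof
      fix c assume "c \<in> A (Suc n)"
      then obtain \<omega> where \<omega>: "\<omega> \<in> A n" "c \<in> ch n \<omega>" by (auto simp: split)
      then obtain k where k: "k \<le> n" "\<omega> \<in> G k" using G by auto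
      show "c \<in> (\<Union>k\<le>Suc n. G' k)"
      proof (cases "\<omega> \<in> bad")
        case True
        then have "c \<in> G' (Suc n)" using \<omega> by (auto simp: G'_def)
        then show ?thesis by blast
      next
        case False
        then have "c \<in> G' k" using \<omega> k by (auto simp: G'_def)
        then show ?thesis using k(1) by (meson UN_I atMost_iff le_SucI)
      qed
    qed
    show "(\<Union>k\<le>Suc n. G' k) \<subseteq> A (Suc n)"
      using GA badA by (fastforce simp: G'_def split le_Suc_eq split: if_splits)
  qed
  have "sum (s (Suc n)) (G' k) \<le> (1 + \<epsilon>) ^ (Suc n - k) * D k \<and>
        (\<forall>c\<in>G' k. s (Suc n) c \<le> (1 + \<epsilon> - \<delta>) ^ (Suc n - k) * D k)" if "k \<le> Suc n" for k
  proof (cases "k = Suc n")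
    case True
    have "s (Suc n) c \<le> D (Suc n)" if "c \<in> G' (Suc n)" for c
    proof -
      have "s (Suc n) c \<le> sum (s (Suc n)) (G' (Suc n))"
        using that cover fin[of "Suc n"] nonneg
        by (intro member_le_sum) (auto intro: rev_finite_subset)
      also have "\<dots> = sum t bad" using sum_ch[OF badA] by (simp add: G'_def)
      finally show ?thesis using sum_bad by simp
    qed
    then show ?thesis using True sum_bad sum_ch[OF badA] by (simp add: G'_def)
  next
    case False
    then have k: "k \<le> n" using that by simp
    have good: "t \<omega> \<le> (1 + \<epsilon>) * s n \<omega>" if "\<omega> \<in> G k - bad" for \<omega>
      using that GA[OF k] by (auto simp: bad_def not_less)
    have "sum (s (Suc n)) (G' k) = sum t (G k - bad)"
      using False sum_ch[of "G k - bad"] GA[OF k] by (auto simp: G'_def)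
    also have "\<dots> \<le> (\<Sum>\<omega>\<in>G k - bad. (1 + \<epsilon>) * s n \<omega>)"
      by (intro sum_mono good)
    also have "\<dots> \<le> (\<Sum>\<omega>\<in>G k. (1 + \<epsilon>) * s n \<omega>)"
      using nonneg \<epsilon> finite_subset[OF GA[OF k] fin] by (intro sum_mono2) auto
    also have "\<dots> \<le> (1 + \<epsilon>) * ((1 + \<epsilon>) ^ (n - k) * D k)"
      using Gsum[OF k] \<epsilon> by (simp flip: sum_distrib_left)
    finally have 1: "sum (s (Suc n)) (G' k) \<le> (1 + \<epsilon>) ^ (Suc n - k) * D k"
      using k by (simp add: Suc_diff_le mult.assoc)
    have "s (Suc n) c \<le> (1 + \<epsilon> - \<delta>) ^ (Suc n - k) * D k" if c: "c \<in> G' k" for c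
    proof -
      obtain \<omega> where \<omega>: "\<omega> \<in> G k - bad" "c \<in> ch n \<omega>" using c False by (auto simp: G'_def)
      have "\<omega> \<in> A n" using \<omega> GA[OF k] by auto
      then have "s (Suc n) c \<le> t \<omega> - \<delta> * s n \<omega>" using spread \<omega>(2) by (auto simp: t_def algebra_simps)
      also have "\<dots> \<le> (1 + \<epsilon> - \<delta>) * s n \<omega>" using good[OF \<omega>(1)] by (simp add: algebra_simps)
      also have "\<dots> \<le> (1 + \<epsilon> - \<delta>) * ((1 + \<epsilon> - \<delta>) ^ (n - k) * D k)"
        using Gmax[OF k, of \<omega>] \<omega>(1) \<epsilon> \<delta> by (intro mult_left_mono) auto
      finally show ?thesis using k by (simp add: Suc_diff_le mult.assoc)
    qed
    with 1 show ?thesis by blast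
  qed
  with cover show ?case by blast
qed

section \<open>The Lorentz norm through the tail function\<close>

lemma nn_integral_powr_below:
  fixes a y :: real
  assumes "-1 < a" "0 \<le> y"
  shows "(\<integral>\<^sup>+t. ennreal (t powr a) * indicator {0<..<y} t \<partial>lborel) = ennreal (y powr (a + 1) / (a + 1))"
proof -
  have "(\<integral>\<^sup>+t. ennreal (t powr a) * indicator {0<..<y} t \<partial>lborel)
      = (\<integral>\<^sup>+t. ennreal (indicator {0..y} t * t powr a) \<partial>lborel)"
    by (intro nn_integral_cong_AE eventually_mono[OF AE_conjI[OF AE_lborel_singleton[of 0] AE_lborel_singleton[of y]]])
       (auto simp: indicator_def)
  also have "\<dots> = ennreal (y powr (a + 1) / (a + 1))"
    by (rule nn_integral_has_integral_lebesgue[OF _ has_integral_powr_from_0[OF assms]]) simp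
  finally show ?thesis .
qed

text \<open>Layer cake for one number. The value \<open>c = top\<close> is included because the rearrangement is an extended
  real; the set is then a half line.\<close>

lemma ennreal_le_emeasure_below: "c \<le> emeasure lborel {u. 0 \<le> u \<and> ennreal u < c}"
proof (cases c)
  case (real r)
  have "{u. 0 \<le> u \<and> ennreal u < c} = {0..<r}"
    using real by (auto simp: ennreal_less_iff)
  then show ?thesis using real by simp
next
  case top
  have "ennreal (real n) \<le> emeasure lborel {u. 0 \<le> u \<and> ennreal u < c}" for n
  proof -
    have "{u. 0 \<le> u \<and> ennreal u < c} = {0::real..}" using top by auto
    moreover have "emeasure lborel {0..<real n} \<le> emeasure lborel {0::real..}"
      by (intro emeasure_mono) auto
    ultimately show ?thesis by simp
  qed
  then show ?thesis
    by (metis ennreal_of_nat_eq_real_of_nat ennreal_SUP_of_nat_eq_top SUP_least top.extremum_uniqueI top)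
qed

lemma (in finite_measure) tail_measurable:
  fixes g :: "'a \<Rightarrow> real"
  assumes [measurable]: "g \<in> borel_measurable M"
  shows "(\<lambda>u. measure M {x \<in> space M. u < g x}) \<in> borel_measurable borel"
proof -
  have "mono (\<lambda>u. - measure M {x \<in> space M. u < g x})"
    by (intro monoI) (auto intro!: finite_measure_mono)
  from borel_measurable_uminus[OF borel_measurable_mono[OF this]] show ?thesis by simp
qed

text \<open>The layer-cake form of the norm. Since \<open>u < g\<^sup>*(t)\<close> implies \<open>t < P u\<close>, where \<open>P\<close> is the
  tail function of \<open>norm g\<close>, the value \<open>g\<^sup>*(t)\<close> is at most the length of \<open>{u. t < P u}\<close>; then
  Tonelli exchanges the two integrals and the integral of \<open>t powr (1 / p - 1)\<close> over \<open>{0<..<P u}\<close>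
  is \<open>p * P u powr (1 / p)\<close>. In this form disjoint pieces of \<open>g\<close> add up
  by the subadditivity of \<open>y powr (1 / p)\<close>.\<close>

lemma Lorentz_p1_norm_le_distribution:
  fixes g :: "'a \<Rightarrow> 'b::euclidean_space"
  assumes "prob_space M" and [measurable]: "g \<in> borel_measurable M" and p: "1 < p"
  shows "Lorentz_p1_norm M p g \<le>
     ennreal p * (\<integral>\<^sup>+u\<in>{0..}. ennreal (measure M {x \<in> space M. u < norm (g x)} powr (1 / p)) \<partial>lborel)"
proof -
  interpret prob_space M by fact
  define P where "P u = measure M {x \<in> space M. u < norm (g x)}" for u
  have [measurable]: "P \<in> borel_measurable borel"
    unfolding P_def by (rule tail_measurable) measurable
  have rearr: "decreasing_rearrangement M g t \<le> (\<integral>\<^sup>+u\<in>{0..}. (if t < P u then 1 else 0) \<partial>lborel)"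
    if t: "0 < t" for t
  proof -
    define c where "c = decreasing_rearrangement M g t"
    have "t < P u" if u: "0 \<le> u" "ennreal u < c" for u
    proof (rule ccontr)
      assume "\<not> t < P u"
      then have "emeasure M {x \<in> space M. ennreal u < ennreal (norm (g x))} \<le> ennreal t"
        using t u by (simp add: P_def emeasure_eq_measure ennreal_less_iff)
      then have "c \<le> ennreal u"
        unfolding c_def decreasing_rearrangement_def by (intro Inf_lower) simp
      with u show False by simp
    qed
    then have sub: "{u. 0 \<le> u \<and> ennreal u < c} \<subseteq> {u\<in>space lborel. 0 \<le> u \<and> t < P u}" by auto
    have "c \<le> emeasure lborel {u. 0 \<le> u \<and> ennreal u < c}"
      by (rule ennreal_le_emeasure_below)
    also have "\<dots> \<le> emeasure lborel {u\<in>space lborel. 0 \<le> u \<and> t < P u}"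
      by (rule emeasure_mono[OF sub]) measurable
    also have "\<dots> = (\<integral>\<^sup>+u. indicator {u\<in>space lborel. 0 \<le> u \<and> t < P u} u \<partial>lborel)"
      by (rule nn_integral_indicator[symmetric]) measurable
    also have "\<dots> = (\<integral>\<^sup>+u\<in>{0..}. (if t < P u then 1 else 0) \<partial>lborel)"
      by (intro nn_integral_cong) (auto simp: indicator_def)
    finally show ?thesis by (simp add: c_def)
  qed
  have "Lorentz_p1_norm M p g \<le>
      (\<integral>\<^sup>+t\<in>{0<..}. ennreal (t powr (1 / p) / t) * (\<integral>\<^sup>+u\<in>{0..}. (if t < P u then 1 else 0) \<partial>lborel) \<partial>lborel)"
    unfolding Lorentz_p1_norm_def
    by (intro nn_integral_mono) (auto split: split_indicator intro!: mult_left_mono rearr)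
  also have "\<dots> = (\<integral>\<^sup>+t. \<integral>\<^sup>+u. ennreal (t powr (1 / p) / t) * indicator {0<..} t * indicator {0..} u *
                       (if t < P u then 1 else 0) \<partial>lborel \<partial>lborel)"
    by (simp flip: nn_integral_cmult add: mult_ac)
  also have "\<dots> = (\<integral>\<^sup>+u. \<integral>\<^sup>+t. ennreal (t powr (1 / p) / t) * indicator {0<..} t * indicator {0..} u *
                       (if t < P u then 1 else 0) \<partial>lborel \<partial>lborel)"
    by (rule lborel_pair.Fubini') measurable
  also have "\<dots> = (\<integral>\<^sup>+u. indicator {0..} u *
                     (\<integral>\<^sup>+t. ennreal (t powr (1 / p - 1)) * indicator {0<..<P u} t \<partial>lborel) \<partial>lborel)"
    by (subst nn_integral_cmult[symmetric])
       (auto simp: indicator_def powr_diff intro!: nn_integral_cong)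
  also have "\<dots> = (\<integral>\<^sup>+u. ennreal p * (ennreal (P u powr (1 / p)) * indicator {0..} u) \<partial>lborel)"
  proof -
    have "(\<integral>\<^sup>+t. ennreal (t powr (1 / p - 1)) * indicator {0<..<P u} t \<partial>lborel)
            = ennreal p * ennreal (P u powr (1 / p))" for u
      using nn_integral_powr_below[of "1 / p - 1" "P u"] p
      by (simp add: P_def ennreal_mult'[symmetric] mult.commute)
    then show ?thesis by (simp add: mult_ac)
  qed
  also have "\<dots> = ennreal p * (\<integral>\<^sup>+u\<in>{0..}. ennreal (P u powr (1 / p)) \<partial>lborel)"
    by (rule nn_integral_cmult) measurable
  finally show ?thesis unfolding P_def .
qed

section \<open>Interpolation between total mass and maximal value\<close>

text \<open>Since \<open>z powr (q - 1)\<close> decreases in \<open>z\<close>, each summand satisfies \<open>y * z powr (q - 1) \<le> y powr q\<close> with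
  \<open>z\<close> the total.\<close>

lemma powr_sum_le:
  fixes f :: "'i \<Rightarrow> real"
  assumes "finite I" "\<And>i. i \<in> I \<Longrightarrow> 0 \<le> f i" "0 < q" "q \<le> 1"
  shows "(\<Sum>i\<in>I. f i) powr q \<le> (\<Sum>i\<in>I. f i powr q)"
  using assms
proof (induction I rule: finite_induct)
  case (insert i I)
  have "(f i + sum f I) powr q \<le> f i powr q + sum f I powr q"
  proof (cases "f i + sum f I = 0")
    case False
    define z where "z = f i + sum f I"
    have fi: "0 \<le> f i" and fI: "0 \<le> sum f I" using insert by (auto intro: sum_nonneg)
    then have z: "0 < z" using False by (simp add: z_def)
    have q: "y * z powr (q - 1) \<le> y powr q" if "0 \<le> y" "y \<le> z" for y
    proof (cases "y = 0")
      case False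
      then have "z powr (q - 1) \<le> y powr (q - 1)"
        using that insert.prems by (intro powr_mono2') auto
      then have "y * z powr (q - 1) \<le> y * y powr (q - 1)" using that by (intro mult_left_mono)
      also have "\<dots> = y powr q" using False that by (simp add: powr_diff)
      finally show ?thesis .
    qed simp
    have "z powr q = z * z powr (q - 1)" using z by (simp add: powr_diff)
    also have "\<dots> = f i * z powr (q - 1) + sum f I * z powr (q - 1)"
      by (simp add: z_def algebra_simps)
    also have "\<dots> \<le> f i powr q + sum f I powr q"
      using fi fI by (intro add_mono q) (auto simp: z_def)
    finally show ?thesis by (simp add: z_def)
  qed (use insert in auto)
  also have "\<dots> \<le> f i powr q + (\<Sum>i\<in>I. f i powr q)" using insert by simp
  finally show ?case using insert by simp
qed simp

text \<open>The parameter \<open>l\<close> separates small from large \<open>y\<close>. The linear term integrates to an \<open>L\<^sub>1\<close> norm and the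
  indicator to a supremum norm, so with the best \<open>l\<close> this becomes the interpolation inequality between
  \<open>L\<^sub>1\<close> and \<open>L\<^sub>\<infinity>\<close>.\<close>

lemma powr_le_affine:
  fixes y l q :: real
  assumes "0 \<le> y" "0 < l" "0 < q" "q \<le> 1"
  shows "y powr q \<le> l powr (q - 1) * y + l powr q * of_bool (0 < y)"
proof (cases "y \<le> l")
  case True
  then show ?thesis
    using assms powr_mono2[of q y l] by (cases "y = 0") (auto intro: add_increasing)
next
  case False
  then have "y powr q = y powr (q - 1) * y" using assms by (simp add: powr_diff)
  also have "\<dots> \<le> l powr (q - 1) * y"
    using False assms by (intro mult_right_mono powr_mono2') auto
  finally show ?thesis by (simp add: add_increasing2)
qed

text \<open>Here \<open>P\<close> is the tail function of a function taking the value \<open>h \<omega>\<close> on the atom \<open>\<omega>\<close> of probability \<open>w\<close>,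
  and the atoms are distributed over the pieces \<open>G k\<close>. Each piece is interpolated between its
  \<open>L\<^sub>1\<close> bound \<open>I k\<close> and its supremum bound \<open>H k\<close> with a parameter \<open>l k\<close> of its own.\<close>

lemma distribution_integral_le:
  fixes P :: "real \<Rightarrow> real" and h :: "'b \<Rightarrow> real" and G :: "'k \<Rightarrow> 'b set"
  assumes K: "finite K" "\<And>k. k \<in> K \<Longrightarrow> finite (G k)"
    and P: "\<And>u. 0 \<le> P u" "\<And>u. P u \<le> (\<Sum>k\<in>K. \<Sum>\<omega>\<in>G k. w * of_bool (u < h \<omega>))"
    and w: "0 \<le> w" and h: "\<And>\<omega>. 0 \<le> h \<omega>"
    and I: "\<And>k. k \<in> K \<Longrightarrow> (\<Sum>\<omega>\<in>G k. w * h \<omega>) \<le> I k"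
    and H: "\<And>k \<omega>. k \<in> K \<Longrightarrow> \<omega> \<in> G k \<Longrightarrow> h \<omega> \<le> H k" "\<And>k. k \<in> K \<Longrightarrow> 0 \<le> H k"
    and l: "\<And>k. k \<in> K \<Longrightarrow> 0 < l k" and p: "1 < p"
  shows "(\<integral>\<^sup>+u\<in>{0..}. ennreal (P u powr (1 / p)) \<partial>lborel)
          \<le> ennreal (\<Sum>k\<in>K. l k powr (1 / p - 1) * I k + l k powr (1 / p) * H k)"
proof -
  define q where "q = 1 / p"
  have q: "0 < q" "q \<le> 1" using p by (auto simp: q_def)
  define Q where "Q k u = (\<Sum>\<omega>\<in>G k. w * of_bool (u < h \<omega>))" for k u
  have Q0: "0 \<le> Q k u" for k u unfolding Q_def using w by (intro sum_nonneg) auto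
  have pt: "P u powr q \<le> (\<Sum>k\<in>K. l k powr (q - 1) * Q k u + l k powr q * of_bool (u < H k))" for u
  proof -
    have "P u powr q \<le> (\<Sum>k\<in>K. Q k u) powr q"
      using P[of u] q by (intro powr_mono2) (auto simp: Q_def)
    also have "\<dots> \<le> (\<Sum>k\<in>K. Q k u powr q)" using q K Q0 by (intro powr_sum_le) auto
    also have "\<dots> \<le> (\<Sum>k\<in>K. l k powr (q - 1) * Q k u + l k powr q * of_bool (u < H k))"
    proof (rule sum_mono)
      fix k assume k: "k \<in> K"
      have "0 < Q k u \<Longrightarrow> u < H k"
      proof (rule ccontr)
        assume "0 < Q k u" "\<not> u < H k"
        then have "\<not> u < h \<omega>" if "\<omega> \<in> G k" for \<omega> using H(1)[OF k that] by simp
        then have "Q k u = 0" by (simp add: Q_def)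
        with \<open>0 < Q k u\<close> show False by simp
      qed
      then have "of_bool (0 < Q k u) \<le> (of_bool (u < H k) :: real)" by simp
      then have "l k powr q * of_bool (0 < Q k u) \<le> l k powr q * of_bool (u < H k)"
        by (intro mult_left_mono) auto
      then show "Q k u powr q \<le> l k powr (q - 1) * Q k u + l k powr q * of_bool (u < H k)"
        using powr_le_affine[OF Q0[of k u] l[OF k] q] by linarith
    qed
    finally show ?thesis .
  qed
  have below: "(\<integral>\<^sup>+u. ennreal (of_bool (u < y)) * indicator {0..} u \<partial>lborel) = ennreal y" if "0 \<le> y" for y :: real
  proof -
    have "(\<integral>\<^sup>+u. ennreal (of_bool (u < y)) * indicator {0..} u \<partial>lborel) = (\<integral>\<^sup>+u. indicator {0..<y} u \<partial>lborel)"
      by (intro nn_integral_cong) (auto simp: indicator_def)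
    then show ?thesis using that by simp
  qed
  have [measurable]: "(\<lambda>u::real. of_bool (u < y) :: real) \<in> borel_measurable borel" for y
    by (rule measurable_compose[of "\<lambda>u. u < y" _ "count_space UNIV"]) auto
  have intQ: "(\<integral>\<^sup>+u. ennreal (Q k u) * indicator {0..} u \<partial>lborel) = ennreal (\<Sum>\<omega>\<in>G k. w * h \<omega>)" for k
  proof -
    have "(\<integral>\<^sup>+u. ennreal (Q k u) * indicator {0..} u \<partial>lborel)
        = (\<integral>\<^sup>+u. (\<Sum>\<omega>\<in>G k. ennreal w * (ennreal (of_bool (u < h \<omega>)) * indicator {0..} u)) \<partial>lborel)"
      unfolding Q_def using w
      by (simp add: sum_ennreal[symmetric] ennreal_mult sum_distrib_left sum_distrib_right mult_ac del: sum_ennreal)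
    also have "\<dots> = (\<Sum>\<omega>\<in>G k. ennreal w * (\<integral>\<^sup>+u. ennreal (of_bool (u < h \<omega>)) * indicator {0..} u \<partial>lborel))"
      by (subst nn_integral_sum) (auto simp: nn_integral_cmult)
    also have "\<dots> = ennreal (\<Sum>\<omega>\<in>G k. w * h \<omega>)"
      using w h by (simp add: below sum_ennreal[symmetric] ennreal_mult del: sum_ennreal)
    finally show ?thesis .
  qed
  have [measurable]: "Q k \<in> borel_measurable borel" for k unfolding Q_def by measurable
  have "(\<integral>\<^sup>+u\<in>{0..}. ennreal (P u powr q) \<partial>lborel)
      \<le> (\<integral>\<^sup>+u. (\<Sum>k\<in>K. ennreal (l k powr (q - 1)) * (ennreal (Q k u) * indicator {0..} u) +
            ennreal (l k powr q) * (ennreal (of_bool (u < H k)) * indicator {0..} u)) \<partial>lborel)"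
  proof (rule nn_integral_mono)
    fix u :: real
    have "ennreal (P u powr q) \<le> ennreal (\<Sum>k\<in>K. l k powr (q - 1) * Q k u + l k powr q * of_bool (u < H k))"
      by (rule ennreal_leI[OF pt])
    also have "\<dots> = (\<Sum>k\<in>K. ennreal (l k powr (q - 1)) * ennreal (Q k u) +
            ennreal (l k powr q) * ennreal (of_bool (u < H k)))"
      using Q0 by (simp add: sum_ennreal[symmetric] ennreal_plus ennreal_mult del: sum_ennreal)
    finally show "ennreal (P u powr q) * indicator {0..} u \<le>
        (\<Sum>k\<in>K. ennreal (l k powr (q - 1)) * (ennreal (Q k u) * indicator {0..} u) +
            ennreal (l k powr q) * (ennreal (of_bool (u < H k)) * indicator {0..} u))"
      by (auto simp: indicator_def)
  qed
  also have "\<dots> = (\<Sum>k\<in>K. ennreal (l k powr (q - 1)) * (\<integral>\<^sup>+u. ennreal (Q k u) * indicator {0..} u \<partial>lborel) +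
            ennreal (l k powr q) * (\<integral>\<^sup>+u. ennreal (of_bool (u < H k)) * indicator {0..} u \<partial>lborel))"
    by (subst nn_integral_sum) (auto simp: nn_integral_cmult nn_integral_add)
  also have "\<dots> = (\<Sum>k\<in>K. ennreal (l k powr (q - 1)) * ennreal (\<Sum>\<omega>\<in>G k. w * h \<omega>) +
            ennreal (l k powr q) * ennreal (H k))"
    using H(2) by (intro sum.cong) (auto simp: intQ below simp del:)
  also have "\<dots> = ennreal (\<Sum>k\<in>K. l k powr (q - 1) * (\<Sum>\<omega>\<in>G k. w * h \<omega>) + l k powr q * H k)"
    using w h H(2) by (simp add: sum_ennreal[symmetric] ennreal_plus ennreal_mult sum_nonneg del: sum_ennreal)
  also have "\<dots> \<le> ennreal (\<Sum>k\<in>K. l k powr (q - 1) * I k + l k powr q * H k)"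
    by (intro ennreal_leI sum_mono add_right_mono mult_left_mono I) auto
  finally show ?thesis unfolding q_def .
qed

text \<open>The quasi-triangle inequality for \<open>f - h\<close>: where its norm exceeds \<open>u\<close>, so does one of
  \<open>2 * norm f\<close> and \<open>2 * norm h\<close>, which are taken as \<open>X\<close> and \<open>Y\<close>.\<close>

lemma (in finite_measure) tail_integral_add_le:
  fixes X Y g :: "'a \<Rightarrow> real"
  assumes [measurable]: "X \<in> borel_measurable M" "Y \<in> borel_measurable M"
    and g: "\<And>x. x \<in> space M \<Longrightarrow> g x \<le> X x \<or> g x \<le> Y x" and p: "1 < p"
  shows "(\<integral>\<^sup>+u\<in>{0..}. ennreal (measure M {x \<in> space M. u < g x} powr (1 / p)) \<partial>lborel)
      \<le> (\<integral>\<^sup>+u\<in>{0..}. ennreal (measure M {x \<in> space M. u < X x} powr (1 / p)) \<partial>lborel)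
       + (\<integral>\<^sup>+u\<in>{0..}. ennreal (measure M {x \<in> space M. u < Y x} powr (1 / p)) \<partial>lborel)"
proof -
  define a where "a u = measure M {x \<in> space M. u < X x}" for u
  define b where "b u = measure M {x \<in> space M. u < Y x}" for u
  define c where "c u = measure M {x \<in> space M. u < g x}" for u
  have [measurable]: "a \<in> borel_measurable borel" "b \<in> borel_measurable borel"
    unfolding a_def b_def by (rule tail_measurable, measurable)+
  have abc: "c u powr (1 / p) \<le> a u powr (1 / p) + b u powr (1 / p)" for u
  proof -
    have "c u \<le> measure M ({x \<in> space M. u < X x} \<union> {x \<in> space M. u < Y x})"
      unfolding c_def using g by (intro finite_measure_mono) force+
    also have "\<dots> \<le> a u + b u"
      unfolding a_def b_def by (intro measure_Un_le) measurable
    finally have "c u powr (1 / p) \<le> (a u + b u) powr (1 / p)"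
      using p by (intro powr_mono2) (auto simp: c_def)
    also have "\<dots> \<le> a u powr (1 / p) + b u powr (1 / p)"
      using powr_sum_le[of UNIV "\<lambda>i. if i then a u else b u" "1 / p"] p
      by (simp add: UNIV_bool a_def b_def add.commute)
    finally show ?thesis .
  qed
  have "(\<integral>\<^sup>+u\<in>{0..}. ennreal (c u powr (1 / p)) \<partial>lborel)
      \<le> (\<integral>\<^sup>+u. ennreal (a u powr (1 / p)) * indicator {0..} u + ennreal (b u powr (1 / p)) * indicator {0..} u \<partial>lborel)"
    using abc by (intro nn_integral_mono) (auto simp: indicator_def simp flip: ennreal_plus intro!: ennreal_leI)
  also have "\<dots> = (\<integral>\<^sup>+u\<in>{0..}. ennreal (a u powr (1 / p)) \<partial>lborel) + (\<integral>\<^sup>+u\<in>{0..}. ennreal (b u powr (1 / p)) \<partial>lborel)"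
    by (rule nn_integral_add) measurable
  finally show ?thesis unfolding a_def b_def c_def .
qed

text \<open>For \<open>\<epsilon> = 0\<close> the product is \<open>(1 - \<delta>) powr r < 1\<close>, and it is continuous in \<open>\<epsilon>\<close>.\<close>

lemma exists_contracting_parameter:
  fixes \<delta> r :: real
  assumes "0 < \<delta>" "\<delta> < 1" "0 < r"
  shows "\<exists>\<epsilon>>0. (1 + \<epsilon>) * (1 + \<epsilon> - \<delta>) powr r < 1"
proof -
  have "((\<lambda>\<epsilon>. (1 + \<epsilon>) * (1 + \<epsilon> - \<delta>) powr r) \<longlongrightarrow> (1 + 0) * (1 + 0 - \<delta>) powr r) (at_right 0)"
    using assms by (intro tendsto_intros) auto
  moreover have "(1 + 0) * (1 + 0 - \<delta>) powr r < 1"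
    using assms powr_less_mono2[of r "1 - \<delta>" 1] by simp
  ultimately have "eventually (\<lambda>\<epsilon>. (1 + \<epsilon>) * (1 + \<epsilon> - \<delta>) powr r < 1) (at_right 0)"
    by (rule order_tendstoD)
  moreover have "eventually (\<lambda>\<epsilon>::real. 0 < \<epsilon>) (at_right 0)"
    by (rule eventually_at_right_less)
  ultimately have "eventually (\<lambda>\<epsilon>. 0 < \<epsilon> \<and> (1 + \<epsilon>) * (1 + \<epsilon> - \<delta>) powr r < 1) (at_right 0)"
    by eventually_elim simp
  then show ?thesis using eventually_happens trivial_limit_at_right_real by blast
qed

text \<open>For a piece of age \<open>j\<close> at level \<open>n\<close> the \<open>L\<^sub>1\<close> bound is proportional to \<open>R ^ j\<close> and the supremum
  bound to \<open>m ^ n * \<theta> ^ j\<close>. This \<open>l\<close>, the ratio of the two, makes both terms of the interpolation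
  equal, and their common value decays like \<open>\<rho> ^ j\<close> up to the normalization of level \<open>n\<close>.\<close>

lemma balanced_parameter:
  fixes m R \<theta> q :: real and j n :: nat
  assumes "0 < m" "0 < R" "0 < \<theta>"
  defines "l \<equiv> (R / \<theta>) ^ j / m ^ n"
  defines "\<rho> \<equiv> R powr q * \<theta> powr (1 - q)"
  shows "l powr (q - 1) * R ^ j = m powr ((1 - q) * n) * \<rho> ^ j"
    and "l powr q * (m ^ n * \<theta> ^ j) = m powr ((1 - q) * n) * \<rho> ^ j"
proof -
  obtain a b c where abc: "m = exp a" "R = exp b" "\<theta> = exp c"
    using assms by (metis exp_ln)
  have l: "l = exp (real j * (b - c) - real n * a)"
    by (simp add: l_def abc exp_diff exp_of_nat_mult)
  have \<rho>: "\<rho> ^ j = exp (real j * (q * b + (1 - q) * c))"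
    by (simp add: \<rho>_def abc powr_def exp_add exp_of_nat_mult)
  show "l powr (q - 1) * R ^ j = m powr ((1 - q) * n) * \<rho> ^ j"
    unfolding l \<rho> by (simp add: abc powr_def flip: exp_add exp_of_nat_mult) (simp add: algebra_simps)
  show "l powr q * (m ^ n * \<theta> ^ j) = m powr ((1 - q) * n) * \<rho> ^ j"
    unfolding l \<rho> by (simp add: abc powr_def flip: exp_add exp_of_nat_mult) (simp add: algebra_simps)
qed

text \<open>Young's inequality for the convolution of \<open>D\<close> with the geometric sequence, in the form that
  a recursion \<open>e (n + 1) = \<rho> * e n + D (n + 1)\<close> gives directly.\<close>

lemma sum_geometric_convolution_le:
  fixes D :: "nat \<Rightarrow> real"
  assumes \<rho>: "0 \<le> \<rho>" "\<rho> < 1" and D: "\<And>k. 0 \<le> D k"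
  shows "(\<Sum>n\<le>N. \<Sum>k\<le>n. \<rho> ^ (n - k) * D k) \<le> (\<Sum>k\<le>N. D k) / (1 - \<rho>)"
proof -
  define e where "e n = (\<Sum>k\<le>n. \<rho> ^ (n - k) * D k)" for n
  have e_Suc: "e (Suc n) = \<rho> * e n + D (Suc n)" for n
    by (auto simp: e_def sum_distrib_left Suc_diff_le mult_ac intro!: sum.cong)
  have "(1 - \<rho>) * (\<Sum>n\<le>N. e n) + \<rho> * e N = (\<Sum>k\<le>N. D k)" for N
  proof (induction N)
    case 0
    then show ?case by (simp add: e_def algebra_simps)
  next
    case (Suc N)
    have "(1 - \<rho>) * (\<Sum>n\<le>Suc N. e n) + \<rho> * e (Suc N)
        = ((1 - \<rho>) * (\<Sum>n\<le>N. e n) + \<rho> * e N) + D (Suc N)"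
      by (simp add: e_Suc algebra_simps)
    then show ?case using Suc.IH by simp
  qed
  moreover have "0 \<le> \<rho> * e N" using \<rho> D by (auto simp: e_def intro!: sum_nonneg mult_nonneg_nonneg)
  ultimately have "(1 - \<rho>) * (\<Sum>n\<le>N. e n) \<le> (\<Sum>k\<le>N. D k)" by (metis le_add_same_cancel1)
  then show ?thesis using \<rho> by (simp add: e_def field_simps)
qed

section \<open>Atoms of a uniform filtration\<close>

lemma atom_subset:
  assumes "\<omega> \<in> atoms N" "B \<in> sets N" "B \<inter> \<omega> \<noteq> {}"
  shows "\<omega> \<subseteq> B"
proof -
  have "\<omega> \<in> sets N" and atom: "\<forall>B\<in>sets N. B \<subseteq> \<omega> \<longrightarrow> B = {} \<or> B = \<omega>"
    using assms(1) by (simp_all add: atoms_def)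
  with assms(2) have "B \<inter> \<omega> \<in> sets N" by (intro sets.Int)
  with atom assms(3) have "B \<inter> \<omega> = \<omega>" by (metis Int_lower2)
  then show ?thesis by blast
qed

lemma atoms_disjoint:
  assumes "\<omega> \<in> atoms N" "\<omega>' \<in> atoms N" "\<omega> \<noteq> \<omega>'"
  shows "\<omega> \<inter> \<omega>' = {}"
proof (rule ccontr)
  assume ne: "\<omega> \<inter> \<omega>' \<noteq> {}"
  have "\<omega> \<in> sets N" "\<omega>' \<in> sets N" using assms by (simp_all add: atoms_def)
  then have "\<omega> \<subseteq> \<omega>'" "\<omega>' \<subseteq> \<omega>"
    using ne atom_subset[OF assms(1), of \<omega>'] atom_subset[OF assms(2), of \<omega>] by (simp_all add: Int_commute)
  then show False using assms(3) by simp
qed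

text \<open>The set \<open>\<Inter>{A \<in> sets N. x \<in> A}\<close> is measurable by finiteness, and a measurable part of it avoiding \<open>x\<close>
  could be removed, so it is an atom.\<close>

lemma atom_containing:
  assumes fin: "finite (sets N)" and x: "x \<in> space N"
  shows "\<exists>\<omega>\<in>atoms N. x \<in> \<omega>"
proof -
  define S where "S = {A \<in> sets N. x \<in> A}"
  have sub: "S \<subseteq> sets N" by (simp add: S_def)
  have "space N \<in> S" using x by (simp add: S_def)
  then have "S \<noteq> {}" by (metis empty_iff)
  from finite_subset[OF sub fin] this have "(\<Inter>A\<in>S. A) \<in> sets N"
    by (rule sets.finite_INT) (rule subsetD[OF sub])
  then have \<omega>: "\<Inter>S \<in> sets N" by simp
  have x\<omega>: "x \<in> \<Inter>S" by (simp add: S_def)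
  have "B = {} \<or> B = \<Inter>S" if B: "B \<in> sets N" "B \<subseteq> \<Inter>S" for B
  proof (cases "x \<in> B")
    case True
    then have "B \<in> S" using B by (simp add: S_def)
    then have "\<Inter>S \<subseteq> B" by (rule Inter_lower)
    with B(2) show ?thesis by simp
  next
    case False
    have "\<Inter>S - B \<in> sets N" using \<omega> B(1) by (rule sets.Diff)
    with False x\<omega> have "\<Inter>S - B \<in> S" by (subst S_def) (simp del: Inter_iff)
    then have "\<Inter>S \<subseteq> \<Inter>S - B" by (rule Inter_lower)
    with B(2) have "B = {}" by blast
    then show ?thesis ..
  qed
  moreover have "\<Inter>S \<noteq> {}" using x\<omega> by (metis empty_iff)
  ultimately have "\<Inter>S \<in> atoms N" using \<omega> by (simp add: atoms_def)
  then show ?thesis using x\<omega> by (rule bexI[rotated])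
qed

text \<open>The choice of the point is immaterial for functions measurable with respect to the algebra,
  which are constant on its atoms.\<close>

definition atom_value :: "('a \<Rightarrow> 'b) \<Rightarrow> 'a set \<Rightarrow> 'b" where
  "atom_value X \<omega> = X (SOME x. x \<in> \<omega>)"

lemma atom_value_eq:
  fixes X :: "'a \<Rightarrow> 'b::euclidean_space"
  assumes X: "X \<in> borel_measurable N" and \<omega>: "\<omega> \<in> atoms N" and x: "x \<in> \<omega>"
  shows "atom_value X \<omega> = X x"
proof -
  have sub: "\<omega> \<subseteq> space N" using \<omega> sets.sets_into_space by (auto simp: atoms_def)
  have "X -` {X x} \<inter> space N \<in> sets N" using X by (rule measurable_sets) auto
  then have "\<omega> \<subseteq> X -` {X x} \<inter> space N"
    using x sub by (intro atom_subset[OF \<omega>]) auto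
  moreover have "(SOME y. y \<in> \<omega>) \<in> \<omega>" using x by (rule someI)
  ultimately show ?thesis by (auto simp: atom_value_def)
qed

locale uniform_filtered_space = prob_space M for M :: "'a measure" +
  fixes F :: "nat \<Rightarrow> 'a measure" and m :: nat
  assumes uniform: "uniform_filtration m M F" and m_pos: "0 < m"
begin

lemma space_F: "space (F n) = space M"
  and sets_F: "sets (F n) \<subseteq> sets M"
  and finite_F: "finite (sets (F n))"
  and sets_F_Suc: "sets (F n) \<subseteq> sets (F (Suc n))"
  and sets_F_0: "sets (F 0) = {{}, space M}"
proof -
  have "filtration (space M) F" and sub: "subalgebra M (F n)"
    using uniform by (simp_all add: uniform_filtration_def)
  then show "sets (F n) \<subseteq> sets (F (Suc n))" by (intro filtration.sets_F_mono) simp_all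
  show "space (F n) = space M" "sets (F n) \<subseteq> sets M"
    using sub by (simp_all add: subalgebra_def)
  show "finite (sets (F n))" "sets (F 0) = {{}, space M}"
    using uniform by (simp_all add: uniform_filtration_def)
qed

lemma finite_atoms: "finite (atoms (F n))"
  by (rule finite_subset[OF _ finite_F]) (auto simp: atoms_def)

lemma atoms_sets: "\<omega> \<in> atoms (F n) \<Longrightarrow> \<omega> \<in> sets M"
  using sets_F by (auto simp: atoms_def)

lemma atoms_0: "atoms (F 0) = {space M}"
  using not_empty by (auto simp: atoms_def sets_F_0)

lemma atoms_cover: "(\<Union>\<omega>\<in>atoms (F n). \<omega>) = space M"
proof
  show "(\<Union>\<omega>\<in>atoms (F n). \<omega>) \<subseteq> space M" using atoms_sets sets.sets_into_space by blast
  show "space M \<subseteq> (\<Union>\<omega>\<in>atoms (F n). \<omega>)"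
    using atom_containing[OF finite_F[of n]] by (auto simp: space_F)
qed

lemma atom_sub_Suc:
  assumes c: "c \<in> atoms (F (Suc n))" and \<omega>: "\<omega> \<in> atoms (F n)" and "c \<inter> \<omega> \<noteq> {}"
  shows "c \<in> children F n \<omega>"
proof -
  have "\<omega> \<in> sets (F (Suc n))" using \<omega> sets_F_Suc by (auto simp: atoms_def)
  then show ?thesis using atom_subset[OF c] c assms(3) by (auto simp: children_def)
qed

lemma atoms_Suc: "atoms (F (Suc n)) = (\<Union>\<omega>\<in>atoms (F n). children F n \<omega>)"
proof
  show "atoms (F (Suc n)) \<subseteq> (\<Union>\<omega>\<in>atoms (F n). children F n \<omega>)"
  proof
    fix c assume c: "c \<in> atoms (F (Suc n))"
    then obtain x where x: "x \<in> c" by (auto simp: atoms_def)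
    then have "x \<in> space M" using sets.sets_into_space[OF atoms_sets[OF c]] by blast
    then obtain \<omega> where "\<omega> \<in> atoms (F n)" "x \<in> \<omega>" using atoms_cover[of n] by auto
    then show "c \<in> (\<Union>\<omega>\<in>atoms (F n). children F n \<omega>)" using atom_sub_Suc[OF c] x by blast
  qed
qed (auto simp: children_def)

lemma children_disjoint: "disjoint_family_on (children F n) (atoms (F n))"
  unfolding disjoint_family_on_def
proof (intro ballI impI equals0I)
  fix \<omega> \<omega>' c assume *: "\<omega> \<in> atoms (F n)" "\<omega>' \<in> atoms (F n)" "\<omega> \<noteq> \<omega>'"
    "c \<in> children F n \<omega> \<inter> children F n \<omega>'"
  then have "c \<subseteq> \<omega> \<inter> \<omega>'" "c \<noteq> {}" by (auto simp: children_def atoms_def)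
  then show False using atoms_disjoint[OF *(1-3)] by auto
qed

lemma Union_children:
  assumes \<omega>: "\<omega> \<in> atoms (F n)"
  shows "(\<Union>c\<in>children F n \<omega>. c) = \<omega>"
proof
  show "\<omega> \<subseteq> (\<Union>c\<in>children F n \<omega>. c)"
  proof
    fix x assume x: "x \<in> \<omega>"
    then have "x \<in> space M" using sets.sets_into_space[OF atoms_sets[OF \<omega>]] by blast
    then obtain c where "c \<in> atoms (F (Suc n))" "x \<in> c" using atoms_cover[of "Suc n"] by auto
    then show "x \<in> (\<Union>c\<in>children F n \<omega>. c)" using atom_sub_Suc[OF _ \<omega>] x by blast
  qed
qed (auto simp: children_def)

lemma measure_child:
  assumes \<omega>: "\<omega> \<in> atoms (F n)" and c: "c \<in> children F n \<omega>"
  shows "measure M \<omega> = m * measure M c"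
proof -
  have fin: "finite (children F n \<omega>)"
    using finite_atoms[of "Suc n"] by (rule rev_finite_subset) (auto simp: children_def)
  have card: "card (children F n \<omega>) = m"
    and eq: "\<And>c'. c' \<in> children F n \<omega> \<Longrightarrow> measure M c' = measure M c"
    using uniform \<omega> c unfolding uniform_filtration_def by blast+
  have "measure M \<omega> = measure M (\<Union>c\<in>children F n \<omega>. c)" by (simp only: Union_children[OF \<omega>])
  also have "\<dots> = (\<Sum>c'\<in>children F n \<omega>. measure M c')"
  proof (rule finite_measure_finite_Union[OF fin])
    show "(\<lambda>c. c) ` children F n \<omega> \<subseteq> events"
      using atoms_sets[of _ "Suc n"] by (auto simp: children_def)
    show "disjoint_family_on (\<lambda>c. c) (children F n \<omega>)"
      using atoms_disjoint by (auto simp: disjoint_family_on_def children_def)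
  qed
  also have "\<dots> = m * measure M c" using eq card by simp
  finally show ?thesis .
qed

lemma measure_atom: "\<omega> \<in> atoms (F n) \<Longrightarrow> measure M \<omega> = 1 / real m ^ n"
proof (induction n arbitrary: \<omega>)
  case 0
  then show ?case using prob_space by (simp add: atoms_0)
next
  case (Suc n)
  then obtain \<eta> where "\<eta> \<in> atoms (F n)" "\<omega> \<in> children F n \<eta>" by (auto simp: atoms_Suc)
  then show ?case using measure_child Suc.IH[of \<eta>] m_pos by (force simp: field_simps)
qed

lemma nn_integral_norm_atoms:
  fixes X :: "'a \<Rightarrow> 'b::euclidean_space"
  assumes X: "X \<in> borel_measurable (F n)"
  shows "(\<integral>\<^sup>+x. ennreal (norm (X x)) \<partial>M) = ennreal (\<Sum>\<omega>\<in>atoms (F n). norm (atom_value X \<omega>) / real m ^ n)"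
proof -
  have "(\<integral>\<^sup>+x. ennreal (norm (X x)) \<partial>M)
      = (\<integral>\<^sup>+x. (\<Sum>\<omega>\<in>atoms (F n). ennreal (norm (atom_value X \<omega>)) * indicator \<omega> x) \<partial>M)"
  proof (rule nn_integral_cong)
    fix x assume "x \<in> space M"
    then obtain \<eta> where \<eta>: "\<eta> \<in> atoms (F n)" "x \<in> \<eta>" using atoms_cover[of n] by auto
    have "(\<Sum>\<omega>\<in>atoms (F n). ennreal (norm (atom_value X \<omega>)) * indicator \<omega> x)
        = (\<Sum>\<omega>\<in>atoms (F n). if \<omega> = \<eta> then ennreal (norm (atom_value X \<omega>)) else 0)"
      using \<eta> atoms_disjoint by (intro sum.cong) (auto simp: indicator_def)
    also have "\<dots> = ennreal (norm (X x))"
      using \<eta> finite_atoms atom_value_eq[OF X \<eta>] by simp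
    finally show "ennreal (norm (X x)) = (\<Sum>\<omega>\<in>atoms (F n). ennreal (norm (atom_value X \<omega>)) * indicator \<omega> x)" ..
  qed
  also have "\<dots> = (\<Sum>\<omega>\<in>atoms (F n). ennreal (norm (atom_value X \<omega>)) * emeasure M \<omega>)"
    using atoms_sets by (subst nn_integral_sum) (auto simp: nn_integral_cmult_indicator intro!: sum.cong)
  also have "\<dots> = (\<Sum>\<omega>\<in>atoms (F n). ennreal (norm (atom_value X \<omega>) / real m ^ n))"
    using measure_atom by (intro sum.cong) (auto simp: emeasure_eq_measure ennreal_mult'[symmetric])
  finally show ?thesis by (simp add: sum_ennreal)
qed

lemma prob_tail_le:
  fixes X :: "'a \<Rightarrow> 'b::euclidean_space" and G :: "nat \<Rightarrow> 'a set set"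
  assumes X: "X \<in> borel_measurable (F n)" and G: "atoms (F n) = (\<Union>k\<le>N. G k)"
  shows "prob {x \<in> space M. u < norm (X x)}
         \<le> (\<Sum>k\<le>N. \<Sum>\<omega>\<in>G k. 1 / real m ^ n * of_bool (u < norm (atom_value X \<omega>)))"
proof -
  define B where "B \<omega> = (if u < norm (atom_value X \<omega>) then \<omega> else {})" for \<omega>
  have GA: "G k \<subseteq> atoms (F n)" if "k \<le> N" for k using G that by auto
  have finG: "finite (G k)" if "k \<le> N" for k using GA[OF that] finite_atoms by (rule finite_subset)
  have B: "B \<omega> \<in> events" if "\<omega> \<in> atoms (F n)" for \<omega> using atoms_sets[OF that] by (simp add: B_def)
  have U: "(\<Union>\<omega>\<in>G k. B \<omega>) \<in> events" if "k \<le> N" for k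
    using finG[OF that] B GA[OF that] by (intro sets.finite_UN) auto
  have "prob {x \<in> space M. u < norm (X x)} \<le> prob (\<Union>k\<le>N. \<Union>\<omega>\<in>G k. B \<omega>)"
  proof (rule finite_measure_mono)
    show "{x \<in> space M. u < norm (X x)} \<subseteq> (\<Union>k\<le>N. \<Union>\<omega>\<in>G k. B \<omega>)"
    proof safe
      fix x assume x: "x \<in> space M" "u < norm (X x)"
      then obtain \<eta> where \<eta>: "\<eta> \<in> atoms (F n)" "x \<in> \<eta>" using atoms_cover[of n] by auto
      then have "x \<in> B \<eta>" using x atom_value_eq[OF X \<eta>] by (simp add: B_def)
      then show "x \<in> (\<Union>k\<le>N. \<Union>\<omega>\<in>G k. B \<omega>)" using \<eta>(1) G by auto
    qed
    show "(\<Union>k\<le>N. \<Union>\<omega>\<in>G k. B \<omega>) \<in> events" by (rule sets.finite_UN) (simp_all add: U)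
  qed
  also have "\<dots> \<le> (\<Sum>k\<le>N. prob (\<Union>\<omega>\<in>G k. B \<omega>))"
    using U by (intro finite_measure_subadditive_finite) auto
  also have "\<dots> \<le> (\<Sum>k\<le>N. \<Sum>\<omega>\<in>G k. prob (B \<omega>))"
    using finG B GA by (intro sum_mono finite_measure_subadditive_finite) auto
  also have "\<dots> = (\<Sum>k\<le>N. \<Sum>\<omega>\<in>G k. 1 / real m ^ n * of_bool (u < norm (atom_value X \<omega>)))"
    using GA measure_atom by (intro sum.cong) (auto simp: B_def subset_iff)
  finally show ?thesis .
qed

end

text \<open>The norm of the average is at most the average of the norms: \<open>x\<close> is the mean of the \<open>x + b $ i\<close>.\<close>

lemma norm_average_le:
  fixes b :: "'b::real_normed_vector ^ 'm::finite"
  assumes "b \<in> zero_sum"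
  shows "real CARD('m) * norm x \<le> (\<Sum>i\<in>UNIV. norm (x + b $ i))"
proof -
  have "(\<Sum>i\<in>UNIV. x + b $ i) = real CARD('m) *\<^sub>R x"
    using assms by (simp add: sum.distrib zero_sum_def sum_constant_scaleR)
  then show ?thesis using norm_sum[of "\<lambda>i. x + b $ i" UNIV] by simp
qed

lemma atom_value_children:
  fixes X :: "nat \<Rightarrow> 'a \<Rightarrow> real ^ 'l::finite" and J :: "'a set \<Rightarrow> 'm::finite \<Rightarrow> 'a set"
  assumes X: "X n \<in> borel_measurable (F n)" "X (Suc n) \<in> borel_measurable (F (Suc n))"
    and \<omega>: "\<omega> \<in> atoms (F n)" and J: "J \<omega> j \<in> children F n \<omega>"
    and b: "equals_on_children (J \<omega>) b (\<lambda>x. X (Suc n) x - X n x)"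
  shows "atom_value (X (Suc n)) (J \<omega> j) = atom_value (X n) \<omega> + b $ j"
proof -
  have at: "J \<omega> j \<in> atoms (F (Suc n))" "J \<omega> j \<subseteq> \<omega>" using J by (auto simp: children_def)
  then obtain x where x: "x \<in> J \<omega> j" by (auto simp: atoms_def)
  have "X (Suc n) x - X n x = b $ j" using b x by (simp add: equals_on_children_def)
  then show ?thesis
    using atom_value_eq[OF X(2) at(1) x] atom_value_eq[OF X(1) \<omega>, of x] x at(2)
    by (auto simp: algebra_simps)
qed

section \<open>The embedding\<close>

theorem mainTheorem2:
  fixes M :: "'a measure"
    and F :: "nat \<Rightarrow> 'a measure"
    and J :: "'a set \<Rightarrow> 'm::finite \<Rightarrow> 'a set"
    and W :: "(real ^ 'l::finite ^ 'm) set"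
    and p :: real
  assumes "3 \<le> CARD('m)"
    and "prob_space M"
    and "uniform_filtration CARD('m) M F"
    and "\<And>n \<omega>. \<omega> \<in> atoms (F n) \<Longrightarrow> bij_betw (J \<omega>) UNIV (children F n \<omega>)"
    and "subspace W" and "W \<subseteq> zero_sum"
    and "second_structural_condition W"
    and "1 < p"
  shows "\<exists>C::real. 0 \<le> C \<and>
    (\<forall>X \<in> W_space M F J W.
      (\<Sum>k. ennreal (real CARD('m) powr (- ((p - 1) / p) * real (Suc k))) *
             Lorentz_p1_norm M p (\<lambda>x. X (Suc k) x - X k x))
      \<le> ennreal C * L1_norm M X)"
proof -
  define m where "m = CARD('m)"
  have m: "3 \<le> m" using assms(1) by (simp add: m_def)
  interpret prob_space M by fact
  interpret uniform_filtered_space M F m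
    using assms(3) m by unfold_locales (auto simp: m_def)
  note bij = assms(4) and p = \<open>1 < p\<close>
  obtain \<delta>0 where \<delta>0: "\<delta>0 > 0"
    "\<And>x b j. b \<in> W \<Longrightarrow> \<delta>0 * norm x \<le> (\<Sum>i\<in>UNIV - {j}. norm (x + b $ i))"
    using structural_gap[of W] assms(1,5,6,7) by auto
  \<comment> \<open>The cap \<open>1 / 2\<close> keeps the contraction factor \<open>\<theta>\<close> below positive.\<close>
  define \<delta> where "\<delta> = min (\<delta>0 / m) (1 / 2)"
  have \<delta>: "0 < \<delta>" "\<delta> < 1" using \<delta>0(1) m by (auto simp: \<delta>_def)
  have gap: "\<delta> * m * norm x \<le> (\<Sum>i\<in>UNIV - {j}. norm (x + b $ i))" if "b \<in> W" for x b j
  proof -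
    have "\<delta> * m \<le> \<delta>0" using m by (simp add: \<delta>_def min_def field_simps)
    then have "\<delta> * m * norm x \<le> \<delta>0 * norm x" by (rule mult_right_mono) simp
    with \<delta>0(2)[OF that] show ?thesis by (meson order_trans)
  qed
  obtain \<epsilon> where \<epsilon>: "0 < \<epsilon>" "(1 + \<epsilon>) * (1 + \<epsilon> - \<delta>) powr (p - 1) < 1"
    using exists_contracting_parameter[of \<delta> "p - 1"] \<delta> p by auto
  define q where "q = 1 / p"
  have q: "0 < q" "q < 1" using p by (auto simp: q_def)
  define \<theta> where "\<theta> = 1 + \<epsilon> - \<delta>"
  have \<theta>: "0 < \<theta>" using \<delta> \<epsilon> by (simp add: \<theta>_def)
  \<comment> \<open>The choice of \<open>\<epsilon>\<close> amounts to \<open>\<rho> < 1\<close>: the decay of the maxima outweighs the growth of the masses.\<close>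
  define \<rho> where "\<rho> = (1 + \<epsilon>) powr q * \<theta> powr (1 - q)"
  have "\<rho> = ((1 + \<epsilon>) * \<theta> powr (p - 1)) powr q"
    using \<epsilon>(1) \<theta> p by (simp add: \<rho>_def powr_mult powr_powr q_def diff_divide_distrib)
  also have "\<dots> < 1 powr q"
    using \<epsilon> \<theta> q by (intro powr_less_mono2) (auto simp: \<theta>_def)
  finally have \<rho>: "0 \<le> \<rho>" "\<rho> < 1" by (simp_all add: \<rho>_def)
  \<comment> \<open>A factor \<open>4\<close> comes from the interpolation of \<open>2 *\<^sub>R X n\<close>, which has two equal terms, and a factor \<open>2\<close> from \<open>X (Suc k)\<close> and \<open>X k\<close> both entering the difference.\<close>
  define C where "C = 8 * p / (1 - \<rho>) * (1 + 1 / \<epsilon>)"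
  have C: "0 \<le> C" using p \<rho> \<epsilon> by (simp add: C_def)
  have "(\<Sum>k. ennreal (real m powr (- ((p - 1) / p) * real (Suc k))) *
             Lorentz_p1_norm M p (\<lambda>x. X (Suc k) x - X k x)) \<le> ennreal C * L1_norm M X"
    if X: "X \<in> W_space M F J W" for X
  proof -
    have XF: "X n \<in> borel_measurable (F n)" for n
      using X by (auto simp: W_space_def is_martingale_def)
    have XM [measurable]: "X n \<in> borel_measurable M" for n
      using XF[of n] by (rule measurable_from_subalg[rotated])
        (simp add: subalgebra_def space_F sets_F)
    \<comment> \<open>The mass carried by an atom: its probability is \<open>1 / m ^ n\<close>, so \<open>S n\<close> is \<open>E (norm X\<^sub>n)\<close>.\<close>
    define s where "s n \<omega> = norm (atom_value (X n) \<omega>) / real m ^ n" for n \<omega>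
    define S where "S n = sum (s n) (atoms (F n))" for n
    define D where "D k = (case k of 0 \<Rightarrow> S 0 | Suc j \<Rightarrow> (1 + 1 / \<epsilon>) * (S (Suc j) - S j))" for k
    have s0: "0 \<le> s n \<omega>" for n \<omega> by (simp add: s_def)
    have kids: "\<exists>b\<in>W. \<exists>x. s n \<omega> = norm x / real m ^ n \<and>
        (\<forall>j. s (Suc n) (J \<omega> j) = norm (x + b $ j) / real m ^ Suc n) \<and>
        sum (s (Suc n)) (children F n \<omega>) = (\<Sum>j\<in>UNIV. norm (x + b $ j)) / real m ^ Suc n"
      if \<omega>: "\<omega> \<in> atoms (F n)" for n \<omega>
    proof -
      obtain b where b: "b \<in> W" "equals_on_children (J \<omega>) b (\<lambda>x. X (Suc n) x - X n x)"
        using X \<omega> by (auto simp: W_space_def)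
      have J: "J \<omega> j \<in> children F n \<omega>" for j using bij[OF \<omega>] by (auto simp: bij_betw_def)
      have sj: "s (Suc n) (J \<omega> j) = norm (atom_value (X n) \<omega> + b $ j) / real m ^ Suc n" for j
        using atom_value_children[of X n F \<omega> J j b] XF \<omega> J b(2) by (simp add: s_def)
      have "sum (s (Suc n)) (children F n \<omega>) = (\<Sum>j\<in>UNIV. s (Suc n) (J \<omega> j))"
        by (rule sum.reindex_bij_betw[OF bij[OF \<omega>], symmetric])
      also have "\<dots> = (\<Sum>j\<in>UNIV. norm (atom_value (X n) \<omega> + b $ j)) / real m ^ Suc n"
        by (simp only: sj sum_divide_distrib)
      finally show ?thesis using sj s_def b(1) by blast
    qed
    have grow: "s n \<omega> \<le> sum (s (Suc n)) (children F n \<omega>)" if \<omega>: "\<omega> \<in> atoms (F n)" for n \<omega>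
    proof -
      obtain b x where bx: "b \<in> W" "s n \<omega> = norm x / real m ^ n"
        "sum (s (Suc n)) (children F n \<omega>) = (\<Sum>j\<in>UNIV. norm (x + b $ j)) / real m ^ Suc n"
        using kids[OF \<omega>] by blast
      have "m * norm x \<le> (\<Sum>j\<in>UNIV. norm (x + b $ j))"
        using norm_average_le[of b x] bx(1) \<open>W \<subseteq> zero_sum\<close> by (auto simp: m_def)
      then show ?thesis using m by (simp add: bx field_simps)
    qed
    have spread: "s (Suc n) c + \<delta> * s n \<omega> \<le> sum (s (Suc n)) (children F n \<omega>)"
      if \<omega>: "\<omega> \<in> atoms (F n)" and c: "c \<in> children F n \<omega>" for n \<omega> c
    proof -
      obtain b x where bx: "b \<in> W" "s n \<omega> = norm x / real m ^ n"
        "\<And>j. s (Suc n) (J \<omega> j) = norm (x + b $ j) / real m ^ Suc n"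
        "sum (s (Suc n)) (children F n \<omega>) = (\<Sum>j\<in>UNIV. norm (x + b $ j)) / real m ^ Suc n"
        using kids[OF \<omega>] by blast
      obtain j where j: "c = J \<omega> j" using bij[OF \<omega>] c by (auto simp: bij_betw_def)
      have "norm (x + b $ j) + \<delta> * m * norm x \<le> (\<Sum>j\<in>UNIV. norm (x + b $ j))"
        using gap[OF bx(1), of x j] by (simp add: sum.remove[of UNIV j])
      then have "(norm (x + b $ j) + \<delta> * m * norm x) / real m ^ Suc n \<le> (\<Sum>j\<in>UNIV. norm (x + b $ j)) / real m ^ Suc n"
        by (rule divide_right_mono) simp
      then show ?thesis using m by (simp add: bx j add_divide_distrib)
    qed
    have S_mono: "S n \<le> S (Suc n)" for n
    proof -
      have "S n \<le> (\<Sum>\<omega>\<in>atoms (F n). sum (s (Suc n)) (children F n \<omega>))"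
        unfolding S_def by (intro sum_mono grow)
      also have "\<dots> = S (Suc n)"
        unfolding S_def atoms_Suc using finite_atoms children_disjoint[of n]
        by (intro sum.UNION_disjoint[symmetric])
           (auto simp: disjoint_family_on_def intro: finite_subset[OF _ finite_atoms[of "Suc n"]] simp: children_def)
      finally show ?thesis .
    qed
    have D0: "0 \<le> D k" for k
      using S_mono \<epsilon>(1) by (cases k) (auto simp: D_def S_def s0 intro!: sum_nonneg mult_nonneg_nonneg)
    \<comment> \<open>The factor \<open>2\<close> prepares the splitting of the differences in \<open>tail_integral_add_le\<close>.\<close>
    define \<Phi> where "\<Phi> n = (\<integral>\<^sup>+u\<in>{0..}. ennreal (prob {x \<in> space M. u < norm (2 *\<^sub>R X n x)} powr (1 / p)) \<partial>lborel)" for n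
    define e where "e n = (\<Sum>k\<le>n. \<rho> ^ (n - k) * D k)" for n
    have e0: "0 \<le> e n" for n using \<rho> D0 by (auto simp: e_def intro!: sum_nonneg)
    \<comment> \<open>Interpolation on each piece of the cover; the weight of level \<open>n\<close> cancels the power of \<open>m\<close>.\<close>
    have \<Phi>_le: "\<Phi> n \<le> ennreal (real m powr ((1 - q) * n) * (4 * e n))" for n
    proof -
      obtain G where G: "atoms (F n) = (\<Union>k\<le>n. G k)"
        and G': "\<forall>k\<le>n. sum (s n) (G k) \<le> (1 + \<epsilon>) ^ (n - k) * D k \<and>
                  (\<forall>\<omega>\<in>G k. s n \<omega> \<le> (1 + \<epsilon> - \<delta>) ^ (n - k) * D k)"
        using good_children_cover[where A = "\<lambda>n. atoms (F n)" and ch = "children F" and s = s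
            and \<epsilon> = \<epsilon> and \<delta> = \<delta> and D = D and n = n and r = "space M",
            OF finite_atoms atoms_0 atoms_Suc children_disjoint s0 grow spread \<epsilon>(1)] \<delta>
        by (auto simp: D_def S_def atoms_0)
      define X2 where "X2 = (\<lambda>x. 2 *\<^sub>R X n x)"
      have X2: "X2 \<in> borel_measurable (F n)" using XF[of n] by (simp add: X2_def)
      have val: "norm (atom_value X2 \<omega>) = 2 * real m ^ n * s n \<omega>" for \<omega>
        using m by (simp add: X2_def s_def atom_value_def)
      define l where "l k = ((1 + \<epsilon>) / \<theta>) ^ (n - k) / real m ^ n" for k
      have "\<Phi> n \<le> ennreal (\<Sum>k\<le>n. l k powr (1 / p - 1) * (2 * ((1 + \<epsilon>) ^ (n - k) * D k)) +
                                 l k powr (1 / p) * (2 * real m ^ n * (\<theta> ^ (n - k) * D k)))"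
        unfolding \<Phi>_def X2_def[symmetric]
      proof (rule distribution_integral_le)
        show "prob {x \<in> space M. u < norm (2 *\<^sub>R X n x)}
           \<le> (\<Sum>k\<le>n. \<Sum>\<omega>\<in>G k. 1 / real m ^ n * of_bool (u < norm (atom_value X2 \<omega>)))" for u
          using prob_tail_le[OF X2 G, of u] by (simp add: X2_def)
        show "finite (G k)" if "k \<in> {..n}" for k
          using finite_atoms[of n] by (rule rev_finite_subset) (use G that in auto)
        show "(\<Sum>\<omega>\<in>G k. 1 / real m ^ n * norm (atom_value X2 \<omega>)) \<le> 2 * ((1 + \<epsilon>) ^ (n - k) * D k)"
          if "k \<in> {..n}" for k
          using G' that m by (simp add: val flip: sum_distrib_left)
        show "norm (atom_value X2 \<omega>) \<le> 2 * real m ^ n * (\<theta> ^ (n - k) * D k)"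
          if "k \<in> {..n}" "\<omega> \<in> G k" for k \<omega>
          using G' that m unfolding val \<theta>_def by (intro mult_left_mono) auto
        show "0 < l k" for k using \<epsilon> \<theta> m by (simp add: l_def)
      qed (use p D0 \<theta> in auto)
      also have "(\<Sum>k\<le>n. l k powr (1 / p - 1) * (2 * ((1 + \<epsilon>) ^ (n - k) * D k)) +
                                 l k powr (1 / p) * (2 * real m ^ n * (\<theta> ^ (n - k) * D k)))
            = (\<Sum>k\<le>n. 2 * D k * (l k powr (q - 1) * (1 + \<epsilon>) ^ (n - k)) +
                       2 * D k * (l k powr q * (real m ^ n * \<theta> ^ (n - k))))"
        by (simp add: q_def mult_ac)
      also have "\<dots> = (\<Sum>k\<le>n. 4 * D k * (real m powr ((1 - q) * n) * \<rho> ^ (n - k)))"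
        using balanced_parameter[of "real m" "1 + \<epsilon>" \<theta>] \<epsilon>(1) \<theta> m
        by (intro sum.cong) (simp_all add: l_def \<rho>_def)
      also have "\<dots> = m powr ((1 - q) * n) * (4 * e n)"
        by (simp add: e_def sum_distrib_left mult_ac)
      finally show ?thesis .
    qed
    have term_le: "ennreal (real m powr (- ((p - 1) / p) * real (Suc k))) *
             Lorentz_p1_norm M p (\<lambda>x. X (Suc k) x - X k x) \<le> ennreal (4 * p * (e (Suc k) + e k))" for k
    proof -
      let ?w = "real m powr ((1 - q) * real (Suc k))"
      have w: "real m powr (- ((p - 1) / p) * real (Suc k)) = 1 / ?w"
      proof -
        have "(p - 1) / p = 1 - q" using p by (simp add: q_def diff_divide_distrib)
        then show ?thesis by (simp only: mult_minus_left powr_minus_divide)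
      qed
      have "real m powr ((1 - q) * k) \<le> ?w" using q m by (intro powr_mono mult_left_mono) auto
      then have \<Phi>k: "\<Phi> k \<le> ennreal (?w * (4 * e k))"
        using e0[of k] by (intro order_trans[OF \<Phi>_le] ennreal_leI mult_right_mono) auto
      have "Lorentz_p1_norm M p (\<lambda>x. X (Suc k) x - X k x) \<le>
        ennreal p * (\<integral>\<^sup>+u\<in>{0..}. ennreal (prob {x \<in> space M. u < norm (X (Suc k) x - X k x)} powr (1 / p)) \<partial>lborel)"
        using p by (intro Lorentz_p1_norm_le_distribution prob_space_axioms) measurable
      also have "\<dots> \<le> ennreal p * (\<Phi> (Suc k) + \<Phi> k)"
        unfolding \<Phi>_def
      proof (intro mult_left_mono tail_integral_add_le)
        show "norm (X (Suc k) x - X k x) \<le> norm (2 *\<^sub>R X (Suc k) x)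
            \<or> norm (X (Suc k) x - X k x) \<le> norm (2 *\<^sub>R X k x)" for x
          using norm_triangle_ineq4[of "X (Suc k) x" "X k x"] by simp linarith
      qed (use p in measurable)
      also have "\<dots> \<le> ennreal p * (ennreal (?w * (4 * e (Suc k))) + ennreal (?w * (4 * e k)))"
        by (intro mult_left_mono add_mono \<Phi>_le \<Phi>k) simp
      also have "\<dots> = ennreal (?w * (4 * p * (e (Suc k) + e k)))"
        using p e0 by (simp add: ennreal_mult'[symmetric] algebra_simps flip: ennreal_plus)
      finally have "ennreal (1 / ?w) * Lorentz_p1_norm M p (\<lambda>x. X (Suc k) x - X k x)
          \<le> ennreal (1 / ?w) * ennreal (?w * (4 * p * (e (Suc k) + e k)))"
        by (rule mult_left_mono) simp
      also have "\<dots> = ennreal (4 * p * (e (Suc k) + e k))"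
        using m by (simp flip: ennreal_mult')
      finally show ?thesis unfolding w .
    qed
    show ?thesis
    proof (rule suminf_le_const[OF summableI])
      fix N
      have "(\<Sum>k<N. ennreal (real m powr (- ((p - 1) / p) * real (Suc k))) *
             Lorentz_p1_norm M p (\<lambda>x. X (Suc k) x - X k x)) \<le> (\<Sum>k<N. ennreal (4 * p * (e (Suc k) + e k)))"
        by (intro sum_mono term_le)
      also have "\<dots> = ennreal (4 * p * ((\<Sum>k<N. e (Suc k)) + (\<Sum>k<N. e k)))"
        using e0 p by (simp add: sum_ennreal sum.distrib flip: sum_distrib_left)
      also have "\<dots> \<le> ennreal (8 * p * (\<Sum>n\<le>N. e n))"
      proof -
        have "(\<Sum>k<N. e (Suc k)) \<le> (\<Sum>n\<le>N. e n)"
          using e0[of 0] by (simp add: sum.atMost_shift)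
        moreover have "(\<Sum>k<N. e k) \<le> (\<Sum>n\<le>N. e n)"
          using e0 by (intro sum_mono2) auto
        ultimately have "(\<Sum>k<N. e (Suc k)) + (\<Sum>k<N. e k) \<le> 2 * (\<Sum>n\<le>N. e n)" by simp
        then have "4 * p * ((\<Sum>k<N. e (Suc k)) + (\<Sum>k<N. e k)) \<le> 4 * p * (2 * (\<Sum>n\<le>N. e n))"
          using p by (intro mult_left_mono) auto
        then show ?thesis by (intro ennreal_leI) simp
      qed
      also have "\<dots> \<le> ennreal (C * S N)"
      proof (rule ennreal_leI)
        \<comment> \<open>The sum of the \<open>D k\<close> telescopes.\<close>
        have SD: "(\<Sum>k\<le>n. D k) \<le> (1 + 1 / \<epsilon>) * S n" for n
        proof (induction n)
          case 0
          have "0 \<le> S 0" using s0 by (auto simp: S_def intro: sum_nonneg)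
          then show ?case using \<epsilon>(1) by (simp add: D_def algebra_simps)
        next
          case (Suc n)
          then show ?case by (simp add: D_def algebra_simps)
        qed
        have "(\<Sum>n\<le>N. e n) \<le> (\<Sum>k\<le>N. D k) / (1 - \<rho>)"
          unfolding e_def by (rule sum_geometric_convolution_le[OF \<rho> D0])
        also have "\<dots> \<le> (1 + 1 / \<epsilon>) * S N / (1 - \<rho>)"
          using SD \<rho> by (intro divide_right_mono) auto
        finally have "8 * p * (\<Sum>n\<le>N. e n) \<le> 8 * p * ((1 + 1 / \<epsilon>) * S N / (1 - \<rho>))"
          using p by (intro mult_left_mono) auto
        then show "8 * p * (\<Sum>n\<le>N. e n) \<le> C * S N" by (simp add: C_def)
      qed
      also have "\<dots> = ennreal C * (\<integral>\<^sup>+x. ennreal (norm (X N x)) \<partial>M)"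
        using C by (simp add: nn_integral_norm_atoms[OF XF] S_def s_def ennreal_mult')
      also have "\<dots> \<le> ennreal C * L1_norm M X"
        unfolding L1_norm_def by (intro mult_left_mono SUP_upper) auto
      finally show "(\<Sum>k<N. ennreal (real m powr (- ((p - 1) / p) * real (Suc k))) *
             Lorentz_p1_norm M p (\<lambda>x. X (Suc k) x - X k x)) \<le> ennreal C * L1_norm M X" .
    qed
  qed
  then show ?thesis using C unfolding m_def by blast
qed

end
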